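(* For a frame $L$ with Esakia space $(X_L,\pi)$, let $\gamma:N(X_L)\to\mathcal{F}_\pi(Y_L)$ be the map $\gamma(N)=N\cap Y_L$. The following conditions are equivalent: (1) The frame $N(L)$ of nuclei on $L$ is spatial. (2) If $N\in N(X_L)$ is nonempty, then so is $N\cap Y_L$. (3) $\gamma:N(X_L)\to\mathcal{F}_\pi(Y_L)$ is one-to-one. (4) $\gamma:N(X_L)\to\mathcal{F}_\pi(Y_L)$ is an isomorphism. (5) $N(L)$ is isomorphic to $\mathcal{O}_\pi(Y_L)$.
   Context: A frame is a complete lattice satisfying $a\wedge\bigvee S=\bigvee\{a\wedge s\mid s\in S\}$; a coframe is the order dual notion. A frame is spatial if it is isomorphic to the frame of open sets of some topological space. A nucleus on a frame $L$ is a map $j:L\to L$ with $a\le ja$, $jja\le ja$, and $j(a\wedge b)=ja\wedge jb$ for all $a,b\in L$. $N(L)$ is the set of all nuclei on $L$ ordered by $j\le k$ iff $ja\le ka$ for all $a\in L$; it is a frame. The Esakia space $X_L$ of $L$ is the set of prime (proper) filters of $L$, ordered by inclusion, with the topology $\pi$ whose basis is $\{\varphi(a)\setminus\varphi(b)\mid a,b\in L\}$, where $\varphi(a)=\{x\in X_L\mid a\in x\}$. For $S\subseteq X_L$, ${\downarrow}S=\{x\mid x\le s\text{ for some }s\in S\}$. A closed subset $F$ of $X_L$ is nuclear if ${\downarrow}(U\cap F)$ is clopen for each clopen $U\subseteq X_L$. $N(X_L)$ is the set of nuclear subsets of $X_L$ ordered by inclusion; it is a coframe. $Y_L=\{y\in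 X_L\mid\{y\}\in N(X_L)\}$ is the set of nuclear points of $X_L$. The subspace topology on $Y_L$ induced by $\pi$ is again denoted $\pi$; $\mathcal{O}_\pi(Y_L)$ is the frame of open sets and $\mathcal{F}_\pi(Y_L)$ the coframe of closed sets of $(Y_L,\pi)$, ordered by inclusion. *)

theory Defs
  imports "HOL-Analysis.Analysis"
begin

text \<open>
  A frame is a type of class \<open>frame\<close>, so the frame \<open>L\<close> is the universe of a type \<open>'a\<close>.
  (The library's class \<open>complete_distrib_lattice\<close> is strictly stronger than this.)
\<close>

class frame = complete_lattice +
  assumes inf_Sup_frame: "inf a (Sup S) = Sup ((\<lambda>s. inf a s) ` S)"

subsection \<open>Isomorphism and spatiality\<close>

text \<open>
  An isomorphism of frames or coframes is the same thing as an order isomorphism, since the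
  lattice operations are determined by the order. The orders used below are the pointwise order
  on functions and inclusion on sets, which are the library's \<open>\<le>\<close> on these types.
\<close>

definition order_iso_on :: "('a::order \<Rightarrow> 'b::order) \<Rightarrow> 'a set \<Rightarrow> 'b set \<Rightarrow> bool" where
  "order_iso_on f A B \<longleftrightarrow>
     bij_betw f A B \<and> (\<forall>x\<in>A. \<forall>y\<in>A. f x \<le> f y \<longleftrightarrow> x \<le> y)"

definition order_isomorphic :: "'a::order set \<Rightarrow> 'b::order set \<Rightarrow> bool" where
  "order_isomorphic A B \<longleftrightarrow> (\<exists>f. order_iso_on f A B)"

text \<open>
  A definition in HOL cannot quantify over the type of points of the space. It is no restriction
  to take the points from \<open>'a set\<close>: lemma \<open>spatialI\<close> below shows that a frame isomorphic
  to the opens of a space with points in any type is spatial in this sense.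
\<close>

definition spatial :: "'a::order set \<Rightarrow> bool" where
  "spatial A \<longleftrightarrow> (\<exists>T :: 'a set topology. order_isomorphic A {U. openin T U})"

lemma spatialI:
  fixes A :: "'a::order set" and T :: "'b topology"
  assumes "order_isomorphic A {U. openin T U}"
  shows "spatial A"
proof -
  obtain f where bij: "bij_betw f A {U. openin T U}"
    and ord: "\<And>x y. x \<in> A \<Longrightarrow> y \<in> A \<Longrightarrow> f x \<subseteq> f y \<longleftrightarrow> x \<le> y"
    using assms unfolding order_isomorphic_def order_iso_on_def by blast
  define h where "h x = {m \<in> A. x \<in> f m}" for x
  define P where "P V = {x \<in> topspace T. h x \<in> V}" for V
  define T' where
    "T' = topology (\<lambda>V. V \<subseteq> h ` topspace T \<and> openin T (P V))"
  have op: "openin T (f m)" if "m \<in> A" for m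
    using bij that by (auto simp: bij_betw_def)
  have "istopology (\<lambda>V. V \<subseteq> h ` topspace T \<and> openin T (P V))"
  proof -
    have "openin T (P (V \<inter> W))" if "openin T (P V)" "openin T (P W)" for V W
    proof -
      have "P (V \<inter> W) = P V \<inter> P W" by (auto simp: P_def)
      then show ?thesis using that by auto
    qed
    moreover have "openin T (P (\<Union>K))" if "\<forall>V\<in>K. openin T (P V)" for K
    proof -
      have "P (\<Union>K) = \<Union>(P ` K)" by (auto simp: P_def)
      then show ?thesis using that by auto
    qed
    ultimately show ?thesis unfolding istopology_def by blast
  qed
  then have T': "openin T' V \<longleftrightarrow> V \<subseteq> h ` topspace T \<and> openin T (P V)" for V
    unfolding T'_def by simp
  have P_img: "P (h ` f m) = f m" if "m \<in> A" for m
  proof -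
    have "f m \<subseteq> topspace T" using op[OF that] by (rule openin_subset)
    moreover have "y \<in> f m" if y: "h y \<in> h ` f m" for y
    proof -
      obtain z where "z \<in> f m" "h y = h z" using y by blast
      then have "m \<in> h y" using \<open>m \<in> A\<close> by (simp add: h_def)
      then show ?thesis by (simp add: h_def)
    qed
    ultimately show ?thesis unfolding P_def by blast
  qed
  have mono: "h ` f m \<subseteq> h ` f n \<longleftrightarrow> m \<le> n" if "m \<in> A" "n \<in> A" for m n
  proof
    assume "h ` f m \<subseteq> h ` f n"
    then have "P (h ` f m) \<subseteq> P (h ` f n)" unfolding P_def by blast
    then show "m \<le> n" using P_img[OF that(1)] P_img[OF that(2)] ord[OF that] by simp
  next
    assume "m \<le> n"
    then have "f m \<subseteq> f n" using ord[OF that] by simp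
    then show "h ` f m \<subseteq> h ` f n" by blast
  qed
  have "bij_betw (\<lambda>m. h ` f m) A {U. openin T' U}"
    unfolding bij_betw_def
  proof
    show "inj_on (\<lambda>m. h ` f m) A"
      proof (rule inj_onI)
      fix m n assume "m \<in> A" "n \<in> A" "h ` f m = h ` f n"
      then have "m \<le> n" "n \<le> m" using mono[of m n] mono[of n m] by simp_all
      then show "m = n" by (rule order.antisym)
    qed
    show "(\<lambda>m. h ` f m) ` A = {U. openin T' U}"
    proof (intro subset_antisym subsetI)
      fix V assume "V \<in> (\<lambda>m. h ` f m) ` A"
      then obtain m where m: "m \<in> A" "V = h ` f m" by blast
      then show "V \<in> {U. openin T' U}"
        using op[OF m(1)] P_img[OF m(1)] openin_subset[OF op[OF m(1)]] by (auto simp: T')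
    next
      fix V assume "V \<in> {U. openin T' U}"
      then have V: "V \<subseteq> h ` topspace T" "openin T (P V)" by (auto simp: T')
      then obtain m where m: "m \<in> A" "f m = P V"
        using bij unfolding bij_betw_def by (metis (no_types, lifting) imageE mem_Collect_eq)
      have "h ` P V = V" using V(1) unfolding P_def by blast
      then show "V \<in> (\<lambda>m. h ` f m) ` A" using m by (metis imageI)
    qed
  qed
  then have "order_iso_on (\<lambda>m. h ` f m) A {U. openin T' U}"
    using mono by (simp add: order_iso_on_def)
  then show ?thesis unfolding spatial_def order_isomorphic_def by blast
qed

subsection \<open>Nuclei\<close>

definition nucleus :: "('a::frame \<Rightarrow> 'a) \<Rightarrow> bool" where
  "nucleus j \<longleftrightarrow>
     (\<forall>a. a \<le> j a) \<and> (\<forall>a. j (j a) \<le> j a) \<and> (\<forall>a b. j (inf a b) = inf (j a) (j b))"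

definition nuclei :: "('a::frame \<Rightarrow> 'a) set" where
  "nuclei = {j. nucleus j}"

subsection \<open>The Esakia space\<close>

definition prime_filter :: "'a::frame set \<Rightarrow> bool" where
  "prime_filter x \<longleftrightarrow>
     x \<noteq> {} \<and> x \<noteq> UNIV \<and>
     (\<forall>a b. a \<in> x \<and> a \<le> b \<longrightarrow> b \<in> x) \<and>
     (\<forall>a b. a \<in> x \<and> b \<in> x \<longrightarrow> inf a b \<in> x) \<and>
     (\<forall>a b. sup a b \<in> x \<longrightarrow> a \<in> x \<or> b \<in> x)"

definition esakia_points :: "'a::frame set set" where
  "esakia_points = {x. prime_filter x}"

definition phi :: "'a::frame \<Rightarrow> 'a set set" where
  "phi a = {x \<in> esakia_points. a \<in> x}"

definition esakia_basis :: "'a::frame set set set" where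
  "esakia_basis = {phi a - phi b | a b. True}"

text \<open>The generating family is a basis, and not only a subbasis, by lemma
  \<open>openin_esakia_space_iff\<close> below.\<close>

definition esakia_space :: "'a::frame set topology" where
  "esakia_space = topology_generated_by esakia_basis"

lemma phi_top [simp]: "phi top = esakia_points"
  unfolding phi_def esakia_points_def prime_filter_def by (blast intro: top_greatest)

lemma phi_bot [simp]: "phi bot = {}"
proof -
  have "bot \<notin> x" if "prime_filter x" for x :: "'a set"
    using that unfolding prime_filter_def by (metis bot_least UNIV_eq_I)
  then show ?thesis by (simp add: phi_def esakia_points_def)
qed

lemma phi_inf: "phi (inf a b) = phi a \<inter> phi b"
proof -
  have "inf a b \<in> x \<longleftrightarrow> a \<in> x \<and> b \<in> x" if "prime_filter x" for x
    using that inf_le1 [of a b] inf_le2 [of a b] unfolding prime_filter_def by meson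
  then show ?thesis by (auto simp: phi_def esakia_points_def)
qed

lemma phi_sup: "phi (sup a b) = phi a \<union> phi b"
proof -
  have "sup a b \<in> x \<longleftrightarrow> a \<in> x \<or> b \<in> x" if "prime_filter x" for x
    using that sup_ge1 [of a b] sup_ge2 [of b a] unfolding prime_filter_def by meson
  then show ?thesis by (auto simp: phi_def esakia_points_def)
qed

lemma topspace_esakia_space [simp]: "topspace esakia_space = esakia_points"
proof -
  have "\<Union>esakia_basis \<subseteq> (esakia_points :: 'a set set)"
    by (auto simp: esakia_basis_def phi_def)
  moreover have "(esakia_points :: 'a set set) \<in> esakia_basis"
  proof -
    have "(esakia_points :: 'a set set) = phi top - phi bot" by simp
    then show ?thesis unfolding esakia_basis_def by blast
  qed
  ultimately show ?thesis unfolding esakia_space_def by auto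
qed

lemma openin_esakia_space_iff:
  "openin esakia_space (U :: 'a::frame set set) \<longleftrightarrow> (\<exists>\<B> \<subseteq> esakia_basis. U = \<Union>\<B>)"
proof
  assume "\<exists>\<B> \<subseteq> esakia_basis. U = \<Union>\<B>"
  then obtain \<B> where "\<B> \<subseteq> esakia_basis" "U = \<Union>\<B>" by blast
  moreover have "openin esakia_space B" if "B \<in> \<B>" for B
    using that \<open>\<B> \<subseteq> esakia_basis\<close> unfolding esakia_space_def
    by (intro topology_generated_by_Basis) (rule subsetD)
  ultimately show "openin esakia_space U" by (simp add: openin_Union)
next
  assume "openin esakia_space U"
  then have "generate_topology_on esakia_basis U"
    by (simp add: esakia_space_def openin_topology_generated_by_iff)
  then have "\<forall>x\<in>U. \<exists>B\<in>esakia_basis. x \<in> B \<and> B \<subseteq> U"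
  proof induction
    case Empty
    then show ?case by simp
  next
    case (Int U V)
    show ?case
    proof
      fix x assume "x \<in> U \<inter> V"
      then obtain B C where BC: "B \<in> esakia_basis" "x \<in> B" "B \<subseteq> U"
        "C \<in> esakia_basis" "x \<in> C" "C \<subseteq> V" using Int.IH by blast
      then obtain a b c d where "B = phi a - phi b" "C = phi c - phi d"
        unfolding esakia_basis_def by blast
      then have "B \<inter> C = phi (inf a c) - phi (sup b d)"
        by (auto simp: phi_inf phi_sup)
      then have "B \<inter> C \<in> esakia_basis" unfolding esakia_basis_def by blast
      then show "\<exists>B\<in>esakia_basis. x \<in> B \<and> B \<subseteq> U \<inter> V" using BC by blast
    qed
  next
    case (UN K)
    show ?case
    proof
      fix x assume "x \<in> \<Union>K"
      then obtain k where k: "k \<in> K" "x \<in> k" by blast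
      then obtain B where "B \<in> esakia_basis" "x \<in> B" "B \<subseteq> k" using UN.IH by blast
      then show "\<exists>B\<in>esakia_basis. x \<in> B \<and> B \<subseteq> \<Union>K" using k(1) by blast
    qed
  next
    case (Basis s)
    then show ?case by blast
  qed
  then have "U = \<Union>{B \<in> esakia_basis. B \<subseteq> U}" by auto
  moreover have "{B \<in> esakia_basis. B \<subseteq> U} \<subseteq> esakia_basis" by (rule Collect_restrict)
  ultimately show "\<exists>\<B> \<subseteq> esakia_basis. U = \<Union>\<B>" by (intro exI conjI)
qed

subsection \<open>Nuclear sets and nuclear points\<close>

definition esakia_downset :: "'a::frame set set \<Rightarrow> 'a set set" where
  "esakia_downset S = {x \<in> esakia_points. \<exists>s\<in>S. x \<subseteq> s}"

definition esakia_clopen :: "'a::frame set set \<Rightarrow> bool" where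
  "esakia_clopen U \<longleftrightarrow> openin esakia_space U \<and> closedin esakia_space U"

definition nuclear_sets :: "'a::frame set set set" where
  "nuclear_sets =
     {F. closedin esakia_space F \<and>
         (\<forall>U. esakia_clopen U \<longrightarrow> esakia_clopen (esakia_downset (U \<inter> F)))}"

definition nuclear_points :: "'a::frame set set" where
  "nuclear_points = {y \<in> esakia_points. {y} \<in> nuclear_sets}"

definition nuclear_space :: "'a::frame set topology" where
  "nuclear_space = subtopology esakia_space nuclear_points"

definition opens_Y :: "'a::frame set set set" where
  "opens_Y = {U. openin nuclear_space U}"

definition closeds_Y :: "'a::frame set set set" where
  "closeds_Y = {C. closedin nuclear_space C}"

definition gamma :: "'a::frame set set \<Rightarrow> 'a set set" where
  "gamma N = N \<inter> nuclear_points"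

lemma gamma_closed: "N \<in> nuclear_sets \<Longrightarrow> gamma N \<in> closeds_Y"
  by (auto simp: nuclear_sets_def closeds_Y_def nuclear_space_def gamma_def closedin_subtopology)

end

theory Submission
  imports Defs
begin

text \<open>
  Sending a nucleus \<open>j\<close> to the set of prime filters \<open>x\<close> with \<open>j a \<in> x \<longrightarrow> a \<in> x\<close> is a dual
  isomorphism between nuclei and nuclear sets: a nucleus is recovered from its set by separating
  with \<open>j\<close>-closed prime filters, and compactness of the Esakia space turns clopen up-sets into
  elements of the frame. Since a nuclear set stays nuclear after intersecting with a clopen, a point
  of \<open>N - M\<close> gives a nonempty nuclear subset of \<open>N\<close> missing \<open>M\<close>; hence (2) makes \<open>\<gamma>\<close> an
  order embedding, and it is always onto because closures of sets of nuclear points are nuclear.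
  Conversely, if \<open>N(L)\<close> is spatial, a point of the space inside the closed set of \<open>N\<close> yields,
  through its closure, a join-irreducible nuclear subset of \<open>N\<close>, and clopen separation
  forces such a set to be a single nuclear point.
\<close>

section \<open>Prime filters\<close>

text \<open>Improper filters are allowed, so filters can be enlarged freely; properness will come
  from avoiding a nonempty ideal.\<close>

definition lattice_filter :: "'a::lattice set \<Rightarrow> bool" where
  "lattice_filter F \<longleftrightarrow> F \<noteq> {} \<and> (\<forall>a b. a \<in> F \<and> a \<le> b \<longrightarrow> b \<in> F) \<and>
     (\<forall>a b. a \<in> F \<and> b \<in> F \<longrightarrow> inf a b \<in> F)"

definition lattice_ideal :: "'a::lattice set \<Rightarrow> bool" where
  "lattice_ideal I \<longleftrightarrow> I \<noteq> {} \<and> (\<forall>a b. b \<in> I \<and> a \<le> b \<longrightarrow> a \<in> I) \<and>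
     (\<forall>a b. a \<in> I \<and> b \<in> I \<longrightarrow> sup a b \<in> I)"

lemma prime_filter_imp_lattice_filter: "prime_filter x \<Longrightarrow> lattice_filter x"
  unfolding prime_filter_def lattice_filter_def by blast

lemma lattice_filter_up: "lattice_filter F \<Longrightarrow> a \<in> F \<Longrightarrow> a \<le> b \<Longrightarrow> b \<in> F"
  unfolding lattice_filter_def by blast

lemma lattice_filter_inf: "lattice_filter F \<Longrightarrow> a \<in> F \<Longrightarrow> b \<in> F \<Longrightarrow> inf a b \<in> F"
  unfolding lattice_filter_def by blast

lemma lattice_filter_top: "lattice_filter F \<Longrightarrow> (top :: 'a::bounded_lattice) \<in> F"
  unfolding lattice_filter_def by (meson all_not_in_conv top_greatest)

lemma lattice_filter_Inf:
  fixes F :: "'a::complete_lattice set"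
  assumes "lattice_filter F" "finite S" "S \<subseteq> F"
  shows "Inf S \<in> F"
  using assms(2,3)
  by (induction S) (simp_all add: lattice_filter_top[OF assms(1)] lattice_filter_inf[OF assms(1)])

text \<open>The set in question is the filter generated by \<open>M\<close> and
  \<open>c\<close>.\<close>

lemma lattice_filter_extend:
  fixes M :: "'a::lattice set"
  assumes "lattice_filter M"
  shows "lattice_filter {e. \<exists>m\<in>M. inf m c \<le> e}"
    and "M \<subseteq> {e. \<exists>m\<in>M. inf m c \<le> e}"
    and "c \<in> {e. \<exists>m\<in>M. inf m c \<le> e}"
proof -
  have "\<exists>m\<in>M. inf m c \<le> inf a b" if "m1 \<in> M" "inf m1 c \<le> a" "m2 \<in> M" "inf m2 c \<le> b" for a b m1 m2
  proof
    show "inf m1 m2 \<in> M" using that assms by (simp add: lattice_filter_inf)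
    show "inf (inf m1 m2) c \<le> inf a b"
      by (meson inf.bounded_iff inf_le1 inf_le2 order_trans that(2,4))
  qed
  moreover obtain m where "m \<in> M" using assms unfolding lattice_filter_def by blast
  ultimately show "lattice_filter {e. \<exists>m\<in>M. inf m c \<le> e}"
    unfolding lattice_filter_def by (auto intro: order_trans)
  show "M \<subseteq> {e. \<exists>m\<in>M. inf m c \<le> e}" using inf_le1 by blast
  show "c \<in> {e. \<exists>m\<in>M. inf m c \<le> e}" using \<open>m \<in> M\<close> inf_le2 by blast
qed

section \<open>Nuclei and the prime filter theorem relative to a nucleus\<close>

lemma inf_sup_frame: "inf (a::'a::frame) (sup b c) = sup (inf a b) (inf a c)"
  using inf_Sup_frame[of a "{b, c}"] by simp

lemma nucleus_increasing: "nucleus j \<Longrightarrow> a \<le> j a"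
  unfolding nucleus_def by blast

lemma nucleus_idem: "nucleus j \<Longrightarrow> j (j a) = j a"
  unfolding nucleus_def by (simp add: order_antisym)

lemma nucleus_inf: "nucleus j \<Longrightarrow> j (inf a b) = inf (j a) (j b)"
  unfolding nucleus_def by blast

lemma nucleus_mono: "nucleus j \<Longrightarrow> a \<le> b \<Longrightarrow> j a \<le> j b"
  by (metis inf.orderE inf_le2 nucleus_inf)

text \<open>Equivalently, \<open>j\<close> maps the complement of \<open>x\<close> into
  itself.\<close>

definition nucleus_closed :: "('a \<Rightarrow> 'a) \<Rightarrow> 'a set \<Rightarrow> bool" where
  "nucleus_closed j x \<longleftrightarrow> (\<forall>a. j a \<in> x \<longrightarrow> a \<in> x)"

text \<open>Zorn's lemma gives a filter \<open>M\<close> that is maximal among the filters above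
  \<open>G\<close> containing no \<open>j i\<close> with \<open>i \<in> I\<close>. Maximality makes
  \<open>M\<close> closed under \<open>j\<close> and, together with distributivity, prime.\<close>

lemma ex_nucleus_closed_prime_filter:
  fixes j :: "'a::frame \<Rightarrow> 'a"
  assumes j: "nucleus j" and G: "lattice_filter G" and I: "lattice_ideal I"
    and GI: "\<And>i. i \<in> I \<Longrightarrow> j i \<notin> G"
  obtains y where "prime_filter y" "nucleus_closed j y" "G \<subseteq> y" "y \<inter> I = {}"
proof -
  define A where "A = {F. lattice_filter F \<and> G \<subseteq> F \<and> (\<forall>i\<in>I. j i \<notin> F)}"
  have "\<exists>M\<in>A. \<forall>X\<in>A. M \<subseteq> X \<longrightarrow> X = M"
  proof (rule subset_Zorn_nonempty)
    show "A \<noteq> {}" using G GI unfolding A_def by blast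
    fix C assume "C \<noteq> {}" and ch: "subset.chain A C"
    then have CA: "C \<subseteq> A" and lin: "\<And>F F'. F \<in> C \<Longrightarrow> F' \<in> C \<Longrightarrow> F \<subseteq> F' \<or> F' \<subseteq> F"
      by (auto simp: subset.chain_def)
    have "lattice_filter (\<Union>C)"
      unfolding lattice_filter_def
    proof (intro conjI allI impI)
      show "\<Union>C \<noteq> {}" using \<open>C \<noteq> {}\<close> CA unfolding A_def lattice_filter_def by blast
      show "b \<in> \<Union>C" if "a \<in> \<Union>C \<and> a \<le> b" for a b
        using that CA unfolding A_def lattice_filter_def by blast
      show "inf a b \<in> \<Union>C" if ab: "a \<in> \<Union>C \<and> b \<in> \<Union>C" for a b
      proof -
        obtain F where "F \<in> C" "a \<in> F" "b \<in> F" using ab lin by blast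
        then show ?thesis using CA unfolding A_def lattice_filter_def by blast
      qed
    qed
    moreover have "G \<subseteq> \<Union>C" using \<open>C \<noteq> {}\<close> CA unfolding A_def by blast
    moreover have "\<forall>i\<in>I. j i \<notin> \<Union>C" using CA unfolding A_def by blast
    ultimately show "\<Union>C \<in> A" unfolding A_def by blast
  qed
  then obtain M where "M \<in> A" and max: "\<And>F. F \<in> A \<Longrightarrow> M \<subseteq> F \<Longrightarrow> F = M" by blast
  then have M: "lattice_filter M" "G \<subseteq> M" and MI: "\<And>i. i \<in> I \<Longrightarrow> j i \<notin> M"
    unfolding A_def by blast+
  \<comment> \<open>The inverse image of \<open>M\<close> under \<open>j\<close> is a filter because
    \<open>j\<close> preserves meets, and it still avoids every \<open>j i\<close> because
    \<open>j\<close> is idempotent. It contains \<open>M\<close>, so by maximality it equals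
    \<open>M\<close>.\<close>
  have closed: "nucleus_closed j M"
  proof -
    have sub: "M \<subseteq> {c. j c \<in> M}"
      using M(1) nucleus_increasing[OF j] by (blast intro: lattice_filter_up)
    moreover have "lattice_filter {c. j c \<in> M}"
      unfolding lattice_filter_def
    proof (intro conjI allI impI)
      show "{c. j c \<in> M} \<noteq> {}" using M(1) sub unfolding lattice_filter_def by blast
      show "b \<in> {c. j c \<in> M}" if "a \<in> {c. j c \<in> M} \<and> a \<le> b" for a b
        using that nucleus_mono[OF j, of a b] lattice_filter_up[OF M(1)] by blast
      show "inf a b \<in> {c. j c \<in> M}" if "a \<in> {c. j c \<in> M} \<and> b \<in> {c. j c \<in> M}" for a b
        using that lattice_filter_inf[OF M(1)] by (simp add: nucleus_inf[OF j])
    qed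
    ultimately have "{c. j c \<in> M} \<in> A"
      using M(2) MI unfolding A_def by (auto simp: nucleus_idem[OF j])
    then show ?thesis using max[OF _ sub] unfolding nucleus_closed_def by blast
  qed
  \<comment> \<open>For \<open>c\<close> outside \<open>M\<close> the filter generated by
    \<open>M\<close> and \<open>c\<close> is strictly larger, so it must contain some
    \<open>j i\<close>.\<close>
  have meets: "\<exists>m\<in>M. \<exists>i\<in>I. inf m c \<le> j i" if "c \<notin> M" for c
  proof (rule ccontr)
    assume "\<not> ?thesis"
    then have "{e. \<exists>m\<in>M. inf m c \<le> e} \<in> A"
      using lattice_filter_extend[OF M(1), of c] M(2) unfolding A_def by blast
    then show False
      using max lattice_filter_extend(2,3)[OF M(1), of c] that by blast
  qed
  \<comment> \<open>The join \<open>sup i i'\<close> serves both witnesses at once, and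
    distributivity then forces \<open>j (sup i i')\<close> into \<open>M\<close>.\<close>
  have prime: "c \<in> M \<or> d \<in> M" if cd: "sup c d \<in> M" for c d
  proof (rule ccontr)
    assume "\<not> ?thesis"
    then obtain m i m' i' where m: "m \<in> M" "i \<in> I" "inf m c \<le> j i" "m' \<in> M" "i' \<in> I" "inf m' d \<le> j i'"
      using meets by meson
    have "inf (inf m m') c \<le> j (sup i i')"
      by (meson inf.bounded_iff inf_le1 inf_le2 m(3) nucleus_mono[OF j sup_ge1] order_trans)
    moreover have "inf (inf m m') d \<le> j (sup i i')"
      by (meson inf.bounded_iff inf_le1 inf_le2 m(6) nucleus_mono[OF j sup_ge2] order_trans)
    ultimately have "inf (inf m m') (sup c d) \<le> j (sup i i')" by (simp add: inf_sup_frame)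
    then have "j (sup i i') \<in> M"
      using M(1) m(1,4) cd by (meson lattice_filter_inf lattice_filter_up)
    moreover have "sup i i' \<in> I" using I m(2,5) unfolding lattice_ideal_def by blast
    ultimately show False using MI by blast
  qed
  obtain i where "i \<in> I" using I unfolding lattice_ideal_def by blast
  then have "M \<noteq> UNIV" using MI by blast
  then have "prime_filter M"
    using M(1) prime unfolding prime_filter_def lattice_filter_def by blast
  moreover have "M \<inter> I = {}"
    using MI nucleus_increasing[OF j] lattice_filter_up[OF M(1)] by blast
  ultimately show thesis using that closed M(2) by blast
qed

text \<open>For the identity nucleus the preceding lemma is the ordinary prime filter
  theorem.\<close>

lemma nucleus_id: "nucleus (\<lambda>a. a)"
  unfolding nucleus_def by simp

lemma lattice_ideal_below: "lattice_ideal {i. i \<le> (b::'a::lattice)}"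
  unfolding lattice_ideal_def by (auto intro: order_trans)

section \<open>The representation of the frame by the sets \<open>phi a\<close>\<close>

lemma phi_mono: "a \<le> b \<Longrightarrow> phi a \<subseteq> phi b"
  unfolding phi_def esakia_points_def prime_filter_def by blast

lemma phi_subset: "phi a \<subseteq> esakia_points"
  unfolding phi_def by blast

text \<open>If \<open>a \<le> b\<close> fails, the principal filter of \<open>a\<close> misses the
  principal ideal of \<open>b\<close>, and a prime filter separates them.\<close>

lemma phi_subset_iff: "phi a \<subseteq> phi b \<longleftrightarrow> a \<le> b"
proof
  assume sub: "phi a \<subseteq> phi b"
  show "a \<le> b"
  proof (rule ccontr)
    assume nle: "\<not> a \<le> b"
    have "lattice_filter {c. a \<le> c}" unfolding lattice_filter_def by (auto intro: order_trans)
    moreover have "i \<notin> {c. a \<le> c}" if "i \<in> {i. i \<le> b}" for i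
      using that nle order_trans by blast
    ultimately obtain y where y: "prime_filter y" "{c. a \<le> c} \<subseteq> y" "y \<inter> {i. i \<le> b} = {}"
      using ex_nucleus_closed_prime_filter[OF nucleus_id _ lattice_ideal_below] by metis
    then have "a \<in> y" "b \<notin> y" by blast+
    then have "y \<in> phi a" "y \<notin> phi b" using y(1) by (simp_all add: phi_def esakia_points_def)
    then show False using sub by blast
  qed
qed (rule phi_mono)

lemma mem_phi_Inf:
  assumes x: "x \<in> esakia_points" and S: "finite S"
  shows "x \<in> phi (Inf S) \<longleftrightarrow> S \<subseteq> x"
proof -
  have filter: "lattice_filter x"
    using x by (simp add: esakia_points_def prime_filter_imp_lattice_filter)
  have "Inf S \<in> x \<longleftrightarrow> S \<subseteq> x"
    using lattice_filter_Inf[OF filter S] lattice_filter_up[OF filter _ Inf_lower] by blast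
  then show ?thesis using x by (simp add: phi_def)
qed

section \<open>Compactness of the Esakia space\<close>

lemma clopen_iff_complement:
  "esakia_clopen (esakia_points - U) \<longleftrightarrow> esakia_clopen U" if "U \<subseteq> esakia_points"
  using that unfolding esakia_clopen_def
  by (metis closedin_def double_diff dual_order.refl openin_closedin_eq topspace_esakia_space)

lemma clopen_subset: "esakia_clopen U \<Longrightarrow> U \<subseteq> esakia_points"
  unfolding esakia_clopen_def using closedin_subset by fastforce

lemma clopen_empty: "esakia_clopen {}"
  unfolding esakia_clopen_def by simp

lemma clopen_Int: "esakia_clopen U \<Longrightarrow> esakia_clopen V \<Longrightarrow> esakia_clopen (U \<inter> V)"
  unfolding esakia_clopen_def by auto

lemma clopen_Un: "esakia_clopen U \<Longrightarrow> esakia_clopen V \<Longrightarrow> esakia_clopen (U \<union> V)"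
  unfolding esakia_clopen_def by auto

lemma clopen_phi: "esakia_clopen (phi a)"
proof -
  have "openin esakia_space (phi c - phi d)" for c d :: 'a
    unfolding esakia_space_def esakia_basis_def by (rule topology_generated_by_Basis) blast
  \<comment> \<open>Both \<open>phi a\<close> and its complement are basic open sets: subtract
    \<open>phi bot\<close>, which is empty, or subtract from \<open>phi top\<close>, which is the
    whole space.\<close>
  from this[of a bot] this[of top a] show ?thesis
    unfolding esakia_clopen_def by (simp add: closedin_def phi_subset)
qed

lemma clopen_phi_diff: "esakia_clopen (phi a - phi b)"
proof -
  have "phi a - phi b = phi a \<inter> (esakia_points - phi b)" using phi_subset by blast
  then show ?thesis by (simp add: clopen_Int clopen_phi clopen_iff_complement phi_subset)
qed

text \<open>The assumption says that the filter generated by \<open>B\<close> misses the ideal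
  generated by \<open>A\<close>. Empty \<open>S\<close> and \<open>T\<close> are allowed and
  contribute \<open>top\<close> and \<open>bot\<close>. Compactness uses the contrapositive: if no
  prime filter contains \<open>B\<close> and avoids \<open>A\<close>, then some finite meet from
  \<open>B\<close> lies below a finite join from \<open>A\<close>.\<close>

lemma prime_filter_extension:
  fixes A B :: "'a::frame set"
  assumes "\<And>S T. finite S \<Longrightarrow> S \<subseteq> B \<Longrightarrow> finite T \<Longrightarrow> T \<subseteq> A \<Longrightarrow> \<not> Inf S \<le> Sup T"
  obtains x where "prime_filter x" "B \<subseteq> x" "x \<inter> A = {}"
proof -
  define F where "F = {c. \<exists>S. finite S \<and> S \<subseteq> B \<and> Inf S \<le> c}"
  define I where "I = {c. \<exists>T. finite T \<and> T \<subseteq> A \<and> c \<le> Sup T}"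
  have F: "lattice_filter F"
    unfolding lattice_filter_def
  proof (intro conjI allI impI)
    show "F \<noteq> {}" unfolding F_def by blast
    show "b \<in> F" if "a \<in> F \<and> a \<le> b" for a b
      using that order_trans unfolding F_def by blast
    show "inf a b \<in> F" if ab: "a \<in> F \<and> b \<in> F" for a b
    proof -
      obtain S S' where "finite S" "S \<subseteq> B" "Inf S \<le> a" "finite S'" "S' \<subseteq> B" "Inf S' \<le> b"
        using ab unfolding F_def by blast
      then show ?thesis
        unfolding F_def
        by (intro CollectI exI[of _ "S \<union> S'"]) (simp_all add: Inf_union_distrib le_infI1 le_infI2)
    qed
  qed
  have I: "lattice_ideal I"
    unfolding lattice_ideal_def
  proof (intro conjI allI impI)
    show "I \<noteq> {}" unfolding I_def by blast
    show "a \<in> I" if "b \<in> I \<and> a \<le> b" for a b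
      using that order_trans unfolding I_def by blast
    show "sup a b \<in> I" if ab: "a \<in> I \<and> b \<in> I" for a b
    proof -
      obtain S S' where "finite S" "S \<subseteq> A" "a \<le> Sup S" "finite S'" "S' \<subseteq> A" "b \<le> Sup S'"
        using ab unfolding I_def by blast
      then show ?thesis
        unfolding I_def
        by (intro CollectI exI[of _ "S \<union> S'"]) (simp_all add: Sup_union_distrib le_supI1 le_supI2)
    qed
  qed
  have "i \<notin> F" if i: "i \<in> I" for i
  proof
    assume "i \<in> F"
    then obtain S T where "finite S" "S \<subseteq> B" "Inf S \<le> i" "finite T" "T \<subseteq> A" "i \<le> Sup T"
      using i unfolding F_def I_def by blast
    then show False using assms[of S T] order_trans by blast
  qed
  then obtain x where x: "prime_filter x" "F \<subseteq> x" "x \<inter> I = {}"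
    using ex_nucleus_closed_prime_filter[OF nucleus_id F I] by metis
  have "B \<subseteq> F"
  proof
    fix b assume "b \<in> B"
    then show "b \<in> F" unfolding F_def by (auto intro!: exI[of _ "{b}"])
  qed
  moreover have "A \<subseteq> I"
  proof
    fix b assume "b \<in> A"
    then show "b \<in> I" unfolding I_def by (auto intro!: exI[of _ "{b}"])
  qed
  ultimately show thesis using that x by blast
qed

text \<open>Alexander's subbase lemma reduces the claim to covers by sets \<open>phi a\<close> with
  \<open>a \<in> A\<close> and complements of \<open>phi b\<close> with \<open>b \<in> B\<close>.
  Such a family covers exactly when no prime filter contains \<open>B\<close> and avoids
  \<open>A\<close>, so the extension lemma provides the finite subcover.\<close>

lemma compact_esakia_space: "compact_space (esakia_space :: 'a::frame set topology)"
proof -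
  define X where "X = (esakia_points :: 'a set set)"
  define \<B> where "\<B> = range phi \<union> range (\<lambda>b. X - phi b)"
  define T where
    "T = topology (arbitrary union_of (finite intersection_of (\<lambda>x. x \<in> \<B>) relative_to X))"
  have sub: "X \<subseteq> \<Union>\<B>" unfolding \<B>_def X_def using phi_top by blast
  have "compact_space T"
  proof (rule Alexander_subbase_alt[OF sub _ T_def[symmetric]])
    fix C assume C: "C \<subseteq> \<B>" "X \<subseteq> \<Union>C"
    define A where "A = {a. phi a \<in> C}"
    define B where "B = {b. X - phi b \<in> C}"
    have no_point: "\<nexists>x. prime_filter x \<and> B \<subseteq> x \<and> x \<inter> A = {}"
    proof
      assume "\<exists>x. prime_filter x \<and> B \<subseteq> x \<and> x \<inter> A = {}"
      then obtain x where x: "prime_filter x" "B \<subseteq> x" "x \<inter> A = {}" by blast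
      then have "x \<in> X" unfolding X_def esakia_points_def by simp
      then obtain c where c: "c \<in> C" "x \<in> c" using C(2) by blast
      then consider a where "c = phi a" | b where "c = X - phi b"
        using C(1) unfolding \<B>_def by blast
      then show False
      proof cases
        case 1
        then show False using c x unfolding A_def phi_def by blast
      next
        case 2
        then show False using c x \<open>x \<in> X\<close> unfolding B_def phi_def X_def by blast
      qed
    qed
    then obtain S S' where S: "finite S" "S \<subseteq> B" "finite S'" "S' \<subseteq> A" "Inf S \<le> Sup S'"
      using prime_filter_extension[of B A] by metis
    \<comment> \<open>A prime filter either omits some element of \<open>S\<close>, or contains
      \<open>Inf S\<close>, hence \<open>Sup S'\<close>, hence by primeness an element of
      \<open>S'\<close>.\<close>
    have "X \<subseteq> \<Union>(phi ` S' \<union> (\<lambda>b. X - phi b) ` S)"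
    proof
      fix x assume x: "x \<in> X"
      show "x \<in> \<Union>(phi ` S' \<union> (\<lambda>b. X - phi b) ` S)"
      proof (cases "S \<subseteq> x")
        case True
        then have "x \<in> phi (Sup S')"
          using x S mem_phi_Inf[of x S] phi_mono[OF S(5)] unfolding X_def by blast
        moreover have "phi (Sup S') = \<Union>(phi ` S')"
          using S(3) by (induction S') (simp_all add: phi_sup)
        ultimately show ?thesis by blast
      next
        case False
        then show ?thesis using x unfolding phi_def by blast
      qed
    qed
    then show "\<exists>C'. finite C' \<and> C' \<subseteq> C \<and> X \<subseteq> \<Union>C'"
      using S(1-4) unfolding A_def B_def by (intro exI[of _ "phi ` S' \<union> (\<lambda>b. X - phi b) ` S"]) auto
  qed
  have top: "topspace T = X" unfolding T_def by (rule topspace_subbase)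
  have subbasic: "openin T U" if "U \<in> \<B>" for U
  proof -
    have "U = X \<inter> U" using that phi_subset unfolding \<B>_def X_def by blast
    moreover have "(finite intersection_of (\<lambda>x. x \<in> \<B>) relative_to X) (X \<inter> U)"
      by (rule relative_to_inc) (simp add: finite_intersection_of_inc that)
    ultimately show ?thesis
      unfolding T_def openin_subbase by (metis arbitrary_union_of_inc)
  qed
  \<comment> \<open>It suffices that \<open>T\<close> is at least as fine as the Esakia topology,
    since compactness passes to coarser topologies on the same points.\<close>
  have "openin T U" if "U \<in> esakia_basis" for U
  proof -
    obtain a b where "U = phi a - phi b"
      using \<open>U \<in> esakia_basis\<close> unfolding esakia_basis_def by blast
    then have "U = phi a \<inter> (X - phi b)" using phi_subset unfolding X_def by blast
    then show ?thesis using subbasic unfolding \<B>_def by blast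
  qed
  then have "openin T U" if "openin esakia_space U" for U
    using that unfolding openin_esakia_space_iff by (metis openin_Union subsetD)
  then show ?thesis
    using \<open>compact_space T\<close> top unfolding compact_space_alt X_def by simp
qed

section \<open>Clopen sets and clopen up-sets\<close>

lemma clopen_compactin: "esakia_clopen U \<Longrightarrow> compactin esakia_space U"
  unfolding esakia_clopen_def by (simp add: closedin_compact_space compact_esakia_space)

text \<open>A clopen set is compact, so finitely many of the basic sets composing it already cover
  it.\<close>

lemma clopen_finite_union:
  assumes "esakia_clopen U"
  obtains \<F> where "finite \<F>" "\<F> \<subseteq> esakia_basis" "U = \<Union>\<F>"
proof -
  obtain \<B> where \<B>: "\<B> \<subseteq> esakia_basis" "U = \<Union>\<B>"
    using assms unfolding esakia_clopen_def openin_esakia_space_iff by blast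
  moreover have "openin esakia_space B" if "B \<in> \<B>" for B
    using that \<B>(1) clopen_phi_diff unfolding esakia_basis_def esakia_clopen_def by blast
  moreover have "compactin esakia_space U" using assms by (rule clopen_compactin)
  ultimately have "\<exists>\<F>. finite \<F> \<and> \<F> \<subseteq> \<B> \<and> U \<subseteq> \<Union>\<F>"
    by (intro compactinD) simp_all
  then obtain \<F> where "finite \<F>" "\<F> \<subseteq> \<B>" "U \<subseteq> \<Union>\<F>" by blast
  moreover have "\<Union>\<F> \<subseteq> U" using \<B>(2) \<open>\<F> \<subseteq> \<B>\<close> by (simp add: Union_mono)
  ultimately show thesis using \<B>(1) by (intro that[of \<F>]) auto
qed

text \<open>Compactness is used twice: on the complement of \<open>V\<close>, to fit a set
  \<open>phi c\<close> between each point of \<open>V\<close> and \<open>V\<close>, and on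
  \<open>V\<close> itself, to reduce these sets to finitely many, whose join is
  \<open>b\<close>.\<close>

lemma clopen_upset_eq_phi:
  fixes V :: "'a::frame set set"
  assumes V: "esakia_clopen V"
    and up: "\<And>x y. x \<in> V \<Longrightarrow> y \<in> esakia_points \<Longrightarrow> x \<subseteq> y \<Longrightarrow> y \<in> V"
  obtains b where "V = phi b"
proof -
  let ?X = "esakia_points :: 'a set set"
  have compact: "compactin esakia_space V" "compactin esakia_space (?X - V)"
    using V clopen_iff_complement[OF clopen_subset[OF V]]
    by (simp_all add: clopen_compactin)
  have open_phi: "openin esakia_space (phi c)" "openin esakia_space (?X - phi c)" for c :: 'a
    using clopen_phi[of c] clopen_iff_complement[OF phi_subset[of c]]
    by (simp_all add: esakia_clopen_def)
  have inner: "\<exists>c. x \<in> phi c \<and> phi c \<subseteq> V" if x: "x \<in> V" for x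
  proof -
    have xX: "x \<in> ?X" using x clopen_subset[OF V] by blast
    \<comment> \<open>A point outside the up-set \<open>V\<close> cannot contain \<open>x\<close>,
      so it omits some \<open>c \<in> x\<close>.\<close>
    have "?X - V \<subseteq> \<Union>((\<lambda>c. ?X - phi c) ` x)"
      using up[OF x] unfolding phi_def by blast
    then obtain \<F> where "finite \<F>" "\<F> \<subseteq> (\<lambda>c. ?X - phi c) ` x" "?X - V \<subseteq> \<Union>\<F>"
      using compactinD[OF compact(2), of "(\<lambda>c. ?X - phi c) ` x"] open_phi(2) by blast
    then obtain S where S: "finite S" "S \<subseteq> x" "?X - V \<subseteq> \<Union>((\<lambda>c. ?X - phi c) ` S)"
      by (metis finite_subset_image)
    have "phi (Inf S) \<subseteq> V"
    proof
      fix y assume y: "y \<in> phi (Inf S)"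
      then have "y \<in> ?X" using phi_subset by blast
      moreover have "S \<subseteq> y" using y calculation S(1) mem_phi_Inf by blast
      ultimately show "y \<in> V" using S(3) unfolding phi_def by blast
    qed
    then show ?thesis using mem_phi_Inf[OF xX S(1)] S(2) by blast
  qed
  have "V \<subseteq> \<Union>{phi c | c. phi c \<subseteq> V}" using inner by blast
  then obtain \<F> where \<F>: "finite \<F>" "\<F> \<subseteq> {phi c | c. phi c \<subseteq> V}" "V \<subseteq> \<Union>\<F>"
    using compactinD[OF compact(1), of "{phi c | c. phi c \<subseteq> V}"] open_phi(1) by blast
  have "\<exists>b. \<Union>\<F> = phi b"
    using \<F>(1,2)
  proof induction
    case empty
    then show ?case using phi_bot by (metis Sup_empty)
  next
    case (insert U \<F>)
    then obtain b c where "\<Union>\<F> = phi b" "U = phi c" by blast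
    then have "\<Union>(insert U \<F>) = phi (sup c b)" by (simp add: phi_sup)
    then show ?case ..
  qed
  moreover have "V = \<Union>\<F>" using \<F> by blast
  ultimately show thesis using that by blast
qed

section \<open>Nuclei and nuclear sets\<close>

definition nuclear_set_of :: "('a::frame \<Rightarrow> 'a) \<Rightarrow> 'a set set" where
  "nuclear_set_of j = {x \<in> esakia_points. nucleus_closed j x}"

text \<open>The supremum is the Heyting implication from \<open>a\<close> to \<open>j b\<close>. A
  prime filter containing it has no \<open>j\<close>-closed prime filter above it that contains
  \<open>a\<close> and omits \<open>b\<close>. For one that omits it, the filter generated together
  with \<open>a\<close> avoids \<open>j i\<close> for all \<open>i \<le> b\<close>, so the relative
  prime filter theorem gives such a point above it.\<close>

lemma downset_phi_diff_Int_nuclear_set_of: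
  fixes j :: "'a::frame \<Rightarrow> 'a"
  assumes j: "nucleus j"
  shows "esakia_downset ((phi a - phi b) \<inter> nuclear_set_of j)
    = esakia_points - phi (Sup {c. inf c a \<le> j b})" (is "?D = _ - phi ?h")
proof -
  \<comment> \<open>The frame law shows that the supremum satisfies its own defining
    inequality.\<close>
  have "inf a ?h = Sup {inf a c | c. inf c a \<le> j b}"
    by (simp add: inf_Sup_frame image_Collect)
  then have h: "inf ?h a \<le> j b" by (auto simp: inf_commute intro: Sup_least)
  have "x \<in> ?D \<longleftrightarrow> ?h \<notin> x" if x: "x \<in> esakia_points" for x
  proof
    assume "x \<in> ?D"
    then obtain y where y: "x \<subseteq> y" "y \<in> phi a" "y \<notin> phi b" "y \<in> esakia_points" "nucleus_closed j y"
      unfolding esakia_downset_def nuclear_set_of_def by blast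
    then have y': "lattice_filter y" "a \<in> y" "b \<notin> y"
      unfolding phi_def esakia_points_def by (simp_all add: prime_filter_imp_lattice_filter)
    show "?h \<notin> x"
    proof
      assume "?h \<in> x"
      then have "j b \<in> y"
        using y(1) y'(1,2) h by (meson lattice_filter_inf lattice_filter_up subsetD)
      then show False using y(5) y'(3) unfolding nucleus_closed_def by blast
    qed
  next
    assume hx: "?h \<notin> x"
    have xf: "lattice_filter x"
      using x by (simp add: esakia_points_def prime_filter_imp_lattice_filter)
    define G where "G = {e. \<exists>m\<in>x. inf m a \<le> e}"
    have G: "lattice_filter G" "x \<subseteq> G" "a \<in> G"
      unfolding G_def using lattice_filter_extend[OF xf] by blast+
    have "j i \<notin> G" if "i \<in> {i. i \<le> b}" for i
    proof
      assume "j i \<in> G"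
      then obtain m where "m \<in> x" "inf m a \<le> j i" unfolding G_def by blast
      moreover have "j i \<le> j b" using that nucleus_mono[OF j] by simp
      ultimately have "m \<le> ?h" by (intro Sup_upper) (simp add: order_trans)
      then show False using hx \<open>m \<in> x\<close> lattice_filter_up[OF xf] by blast
    qed
    then obtain y where "prime_filter y" "nucleus_closed j y" "G \<subseteq> y" "y \<inter> {i. i \<le> b} = {}"
      using ex_nucleus_closed_prime_filter[OF j G(1) lattice_ideal_below] by metis
    then have "y \<in> (phi a - phi b) \<inter> nuclear_set_of j" "x \<subseteq> y"
      using G unfolding phi_def nuclear_set_of_def esakia_points_def by auto
    then show "x \<in> ?D" using x unfolding esakia_downset_def by blast
  qed
  then show ?thesis using phi_subset unfolding phi_def esakia_downset_def by blast
qed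

text \<open>The complement is the union of the open sets \<open>phi (j a) - phi a\<close>. For
  clopen down-sets the preceding formula settles basic \<open>U\<close>, and a general clopen
  \<open>U\<close> is a finite union of basic sets, with which the down-set operation
  commutes.\<close>

lemma nuclear_set_of_nuclear:
  fixes j :: "'a::frame \<Rightarrow> 'a"
  assumes j: "nucleus j"
  shows "nuclear_set_of j \<in> nuclear_sets"
proof -
  let ?N = "nuclear_set_of j"
  have "esakia_points - ?N = \<Union>((\<lambda>a. phi (j a) - phi a) ` UNIV)"
    unfolding nuclear_set_of_def nucleus_closed_def phi_def by auto
  moreover have "openin esakia_space (\<Union>((\<lambda>a. phi (j a) - phi a) ` UNIV))"
    using clopen_phi_diff unfolding esakia_clopen_def by (intro openin_Union) blast
  ultimately have closed: "closedin esakia_space ?N"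
    unfolding closedin_def by (simp add: nuclear_set_of_def)
  have basic: "esakia_clopen (esakia_downset (B \<inter> ?N))" if "B \<in> esakia_basis" for B
    using that downset_phi_diff_Int_nuclear_set_of[OF j]
    by (auto simp: esakia_basis_def clopen_iff_complement[OF phi_subset] clopen_phi)
  have "esakia_clopen (esakia_downset (U \<inter> ?N))" if U: "esakia_clopen U" for U
  proof -
    obtain \<F> where "finite \<F>" "\<F> \<subseteq> esakia_basis" "U = \<Union>\<F>"
      using clopen_finite_union[OF U] .
    moreover have "esakia_clopen (esakia_downset (\<Union>\<F> \<inter> ?N))"
      if "finite \<F>" "\<F> \<subseteq> esakia_basis" for \<F>
      using that
    proof induction
      case empty
      then show ?case by (simp add: esakia_downset_def clopen_empty)
    next
      case (insert B \<F>)
      have "esakia_downset (\<Union>(insert B \<F>) \<inter> ?N)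
          = esakia_downset (B \<inter> ?N) \<union> esakia_downset (\<Union>\<F> \<inter> ?N)"
        unfolding esakia_downset_def by blast
      then show ?case using insert basic by (simp add: clopen_Un)
    qed
    ultimately show ?thesis by blast
  qed
  then show ?thesis using closed unfolding nuclear_sets_def by blast
qed

text \<open>If \<open>k a \<le> j a\<close> fails, the relative prime filter theorem gives a
  \<open>j\<close>-closed prime filter that contains \<open>k a\<close> and omits \<open>a\<close>,
  so it is not \<open>k\<close>-closed.\<close>

lemma nuclear_set_of_subset_iff:
  fixes j k :: "'a::frame \<Rightarrow> 'a"
  assumes j: "nucleus j" and k: "nucleus k"
  shows "nuclear_set_of j \<subseteq> nuclear_set_of k \<longleftrightarrow> k \<le> j"
proof
  assume sub: "nuclear_set_of j \<subseteq> nuclear_set_of k"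
  show "k \<le> j"
  proof (rule le_funI, rule ccontr)
    fix a assume nle: "\<not> k a \<le> j a"
    have G: "lattice_filter {c. k a \<le> c}" unfolding lattice_filter_def by (auto intro: order_trans)
    have "j i \<notin> {c. k a \<le> c}" if "i \<in> {i. i \<le> a}" for i
      using that nle nucleus_mono[OF j, of i a] order_trans by blast
    then obtain y where "prime_filter y"
      "nucleus_closed j y" "{c. k a \<le> c} \<subseteq> y" "y \<inter> {i. i \<le> a} = {}"
      using ex_nucleus_closed_prime_filter[OF j G lattice_ideal_below] by metis
    then have "y \<in> nuclear_set_of j" "k a \<in> y" "a \<notin> y"
      unfolding nuclear_set_of_def esakia_points_def by auto
    then show False using sub unfolding nuclear_set_of_def nucleus_closed_def by blast
  qed
next
  assume "k \<le> j"
  then have "\<And>a. k a \<le> j a" by (simp add: le_funD)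
  then show "nuclear_set_of j \<subseteq> nuclear_set_of k"
    unfolding nuclear_set_of_def nucleus_closed_def esakia_points_def prime_filter_def by blast
qed

section \<open>From nuclear sets back to nuclei\<close>

lemma nuclear_set_subset: "N \<in> nuclear_sets \<Longrightarrow> N \<subseteq> esakia_points"
  unfolding nuclear_sets_def using closedin_subset by fastforce

lemma closed_phi_separation:
  assumes F: "closedin esakia_space F" and x: "x \<in> esakia_points" "x \<notin> F"
  obtains a b where "x \<in> phi a - phi b" "(phi a - phi b) \<inter> F = {}"
proof -
  have "openin esakia_space (esakia_points - F)" using F unfolding closedin_def by simp
  then obtain \<B> where \<B>: "\<B> \<subseteq> esakia_basis" "esakia_points - F = \<Union>\<B>"
    by (metis openin_esakia_space_iff)
  moreover have "x \<in> esakia_points - F" using x by simp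
  ultimately obtain B where B: "B \<in> \<B>" "x \<in> B" by (metis UnionE)
  then have "B \<inter> F = {}" using \<B>(2) by blast
  moreover obtain a b where "B = phi a - phi b"
    using B(1) \<B>(1) unfolding esakia_basis_def by blast
  ultimately show thesis using that B(2) by simp
qed

lemma closed_clopen_separation:
  assumes "closedin esakia_space F" "x \<in> esakia_points" "x \<notin> F"
  obtains U where "esakia_clopen U" "x \<in> U" "U \<inter> F = {}"
proof -
  obtain a b where "x \<in> phi a - phi b" "(phi a - phi b) \<inter> F = {}"
    using closed_phi_separation[OF assms] .
  then show thesis by (rule that[OF clopen_phi_diff])
qed

text \<open>As \<open>N\<close> is nuclear, the down-set of \<open>N - phi a\<close> is clopen; its
  complement is a clopen up-set and hence \<open>phi (j a)\<close> for some element
  \<open>j a\<close>. That \<open>N\<close> is closed lets it be recovered from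
  \<open>j\<close>.\<close>

lemma ex_nucleus_of_nuclear_set:
  fixes N :: "'a::frame set set"
  assumes N: "N \<in> nuclear_sets"
  obtains j where "nucleus j" "nuclear_set_of j = N"
proof -
  let ?D = "\<lambda>a. esakia_downset (N - phi a)"
  have "\<exists>b. phi b = esakia_points - ?D a" for a
  proof -
    have "N - phi a = (esakia_points - phi a) \<inter> N" using nuclear_set_subset[OF N] by blast
    then have "esakia_clopen (?D a)"
      using N clopen_iff_complement[OF phi_subset] clopen_phi unfolding nuclear_sets_def by auto
    moreover have "?D a \<subseteq> esakia_points" unfolding esakia_downset_def by blast
    ultimately have "esakia_clopen (esakia_points - ?D a)" by (simp add: clopen_iff_complement)
    moreover have "y \<in> esakia_points - ?D a"
      if "x \<in> esakia_points - ?D a" "y \<in> esakia_points" "x \<subseteq> y" for x y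
      using that unfolding esakia_downset_def by blast
    ultimately obtain b where "esakia_points - ?D a = phi b" using clopen_upset_eq_phi by metis
    then show ?thesis by blast
  qed
  then obtain j where j: "\<And>a. phi (j a) = esakia_points - ?D a" by metis
  have phi_mem: "x \<in> phi a \<longleftrightarrow> a \<in> x" if "x \<in> esakia_points" for x and a :: 'a
    using that unfolding phi_def by blast
  \<comment> \<open>The nucleus laws are read off from this description of \<open>j a\<close>,
    because inequalities in the frame can be tested on prime filters.\<close>
  have mem_j: "j a \<in> x \<longleftrightarrow> (\<forall>s\<in>N. x \<subseteq> s \<longrightarrow> a \<in> s)" if x: "x \<in> esakia_points" for x a
  proof -
    have "j a \<in> x \<longleftrightarrow> x \<notin> ?D a" using j[of a] phi_mem[OF x, of "j a"] x by simp
    also have "\<dots> \<longleftrightarrow> (\<forall>s\<in>N. x \<subseteq> s \<longrightarrow> s \<in> phi a)"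
      using x unfolding esakia_downset_def by simp (metis DiffI DiffD1 DiffD2)
    also have "\<dots> \<longleftrightarrow> (\<forall>s\<in>N. x \<subseteq> s \<longrightarrow> a \<in> s)"
      using phi_mem[of _ a] nuclear_set_subset[OF N] by (metis subsetD)
    finally show ?thesis .
  qed
  have le: "c \<le> d" if "\<And>x. x \<in> esakia_points \<Longrightarrow> c \<in> x \<Longrightarrow> d \<in> x" for c d :: 'a
    using that phi_subset_iff[of c d] unfolding phi_def by blast
  have inf_mem: "inf c d \<in> x \<longleftrightarrow> c \<in> x \<and> d \<in> x" if "x \<in> esakia_points" for x and c d :: 'a
    using phi_mem[OF that] phi_inf[of c d] by blast
  have "nucleus j"
    unfolding nucleus_def
  proof (intro conjI allI)
    show "a \<le> j a" for a by (rule le) (use mem_j in blast)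
    show "j (j a) \<le> j a" for a
    proof (rule le)
      fix x assume x: "x \<in> esakia_points" "j (j a) \<in> x"
      have "a \<in> s" if "s \<in> N" "x \<subseteq> s" for s
      proof -
        have "j a \<in> s" using mem_j[OF x(1)] x(2) that by blast
        then show ?thesis using mem_j[of s] nuclear_set_subset[OF N] that by blast
      qed
      then show "j a \<in> x" using mem_j[OF x(1)] by blast
    qed
    show "j (inf a b) = inf (j a) (j b)" for a b
    proof -
      have "j (inf a b) \<in> x \<longleftrightarrow> inf (j a) (j b) \<in> x" if x: "x \<in> esakia_points" for x
      proof -
        have "j (inf a b) \<in> x \<longleftrightarrow> (\<forall>s\<in>N. x \<subseteq> s \<longrightarrow> a \<in> s \<and> b \<in> s)"
          using mem_j[OF x, of "inf a b"] inf_mem[of _ a b] nuclear_set_subset[OF N] by blast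
        also have "\<dots> \<longleftrightarrow> inf (j a) (j b) \<in> x"
          using mem_j[OF x] inf_mem[OF x, of "j a" "j b"] by blast
        finally show ?thesis .
      qed
      then show ?thesis by (intro antisym le) blast+
    qed
  qed
  moreover have "nuclear_set_of j = N"
  proof (intro subset_antisym subsetI)
    fix x assume x: "x \<in> N"
    then have "x \<in> esakia_points" using nuclear_set_subset[OF N] by blast
    then show "x \<in> nuclear_set_of j"
      using x mem_j unfolding nuclear_set_of_def nucleus_closed_def by blast
  next
    fix x assume "x \<in> nuclear_set_of j"
    then have x: "x \<in> esakia_points" "\<And>a. j a \<in> x \<Longrightarrow> a \<in> x"
      unfolding nuclear_set_of_def nucleus_closed_def by blast+
    show "x \<in> N"
    proof (rule ccontr)
      assume "x \<notin> N"
      moreover have "closedin esakia_space N" using N unfolding nuclear_sets_def by simp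
      ultimately obtain a b where ab: "x \<in> phi a - phi b" "(phi a - phi b) \<inter> N = {}"
        using closed_phi_separation x(1) by metis
      then have "a \<in> x" "b \<notin> x" using x(1) unfolding phi_def by blast+
      \<comment> \<open>Since \<open>x\<close> is \<open>j\<close>-closed,
        \<open>b \<notin> x\<close> gives \<open>j b \<notin> x\<close>; by the description of
        \<open>j b\<close>, some point of \<open>N\<close> above \<open>x\<close> omits
        \<open>b\<close>.\<close>
      then obtain s where "s \<in> N" "x \<subseteq> s" "b \<notin> s" using x mem_j by blast
      then have "s \<in> phi a - phi b"
        using \<open>a \<in> x\<close> nuclear_set_subset[OF N] unfolding phi_def by blast
      then show False using ab(2) \<open>s \<in> N\<close> by blast
    qed
  qed
  ultimately show thesis using that by blast
qed

section \<open>Clopen pieces and joins of nuclear sets\<close>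

lemma nuclear_Int_clopen:
  assumes "N \<in> nuclear_sets" "esakia_clopen U"
  shows "N \<inter> U \<in> nuclear_sets"
proof -
  have "esakia_clopen (esakia_downset (V \<inter> (N \<inter> U)))" if "esakia_clopen V" for V
  proof -
    \<comment> \<open>Testing \<open>N \<inter> U\<close> with \<open>V\<close> amounts to testing
      \<open>N\<close> with the clopen set \<open>V \<inter> U\<close>.\<close>
    have "V \<inter> (N \<inter> U) = (V \<inter> U) \<inter> N" by blast
    then show ?thesis using assms that clopen_Int unfolding nuclear_sets_def by auto
  qed
  moreover have "closedin esakia_space (N \<inter> U)"
    using assms unfolding nuclear_sets_def esakia_clopen_def by blast
  ultimately show ?thesis unfolding nuclear_sets_def by blast
qed

lemma nuclear_Diff_clopen:
  assumes "N \<in> nuclear_sets" "esakia_clopen U"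
  shows "N - U \<in> nuclear_sets"
proof -
  have "N - U = N \<inter> (esakia_points - U)" using nuclear_set_subset[OF assms(1)] by blast
  then show ?thesis
    using nuclear_Int_clopen[OF assms(1)] clopen_iff_complement[OF clopen_subset] assms(2) by metis
qed

lemma nuclear_empty: "{} \<in> nuclear_sets"
  unfolding nuclear_sets_def esakia_downset_def by (simp add: clopen_empty)

text \<open>Joins of nuclear sets correspond, with the order reversed, to meets of nuclei, and a
  pointwise meet of nuclei is a nucleus. For the empty family \<open>j\<close> is constantly
  \<open>top\<close>, which belongs to the empty nuclear set.\<close>

lemma ex_least_nuclear_superset:
  fixes \<N> :: "'a::frame set set set"
  assumes "\<N> \<subseteq> nuclear_sets"
  obtains N where "N \<in> nuclear_sets" "\<Union>\<N> \<subseteq> N"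
    "\<And>M. M \<in> nuclear_sets \<Longrightarrow> \<Union>\<N> \<subseteq> M \<Longrightarrow> N \<subseteq> M"
proof -
  define K where "K = {k :: 'a \<Rightarrow> 'a. nucleus k \<and> nuclear_set_of k \<in> \<N>}"
  define j where "j a = (INF k\<in>K. k a)" for a
  have j_le: "j a \<le> k a" if "k \<in> K" for k a
    unfolding j_def using that by (rule INF_lower)
  have "nucleus j"
    unfolding nucleus_def
  proof (intro conjI allI)
    show "a \<le> j a" for a
      unfolding j_def by (rule INF_greatest) (simp add: K_def nucleus_increasing)
    show "j (j a) \<le> j a" for a
    proof -
      have "j (j a) \<le> k a" if "k \<in> K" for k
      proof -
        have "nucleus k" using that unfolding K_def by blast
        then have "k (j a) \<le> k a"
          using nucleus_mono[OF _ j_le[OF that]] nucleus_idem by metis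
        then show ?thesis using j_le[OF that, of "j a"] by (rule order_trans[rotated])
      qed
      then show ?thesis unfolding j_def[of a] by (rule INF_greatest)
    qed
    show "j (inf a b) = inf (j a) (j b)" for a b
    proof -
      have "j (inf a b) = (INF k\<in>K. inf (k a) (k b))"
        unfolding j_def by (rule INF_cong) (simp_all add: K_def nucleus_inf)
      then show ?thesis unfolding j_def by (simp add: INF_inf_distrib)
    qed
  qed
  show thesis
  proof (rule that)
    show "nuclear_set_of j \<in> nuclear_sets" using \<open>nucleus j\<close> by (rule nuclear_set_of_nuclear)
    show "\<Union>\<N> \<subseteq> nuclear_set_of j"
    proof (rule Union_least)
      fix A assume "A \<in> \<N>"
      then obtain k where k: "nucleus k" "nuclear_set_of k = A"
        using assms ex_nucleus_of_nuclear_set by blast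
      then have "j \<le> k" using \<open>A \<in> \<N>\<close> j_le by (simp add: K_def le_funI)
      then show "A \<subseteq> nuclear_set_of j"
        using nuclear_set_of_subset_iff[OF k(1) \<open>nucleus j\<close>] k(2) by simp
    qed
    fix M assume M: "M \<in> nuclear_sets" "\<Union>\<N> \<subseteq> M"
    obtain m where m: "nucleus m" "nuclear_set_of m = M"
      using ex_nucleus_of_nuclear_set[OF M(1)] .
    have "m \<le> k" if "k \<in> K" for k
    proof -
      have "nucleus k" "nuclear_set_of k \<subseteq> nuclear_set_of m"
        using that M(2) m(2) unfolding K_def by blast+
      then show ?thesis using nuclear_set_of_subset_iff[OF _ m(1)] by blast
    qed
    then have "m \<le> j" unfolding j_def by (intro le_funI INF_greatest) (simp add: le_funD)
    then show "nuclear_set_of j \<subseteq> M"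
      using nuclear_set_of_subset_iff[OF \<open>nucleus j\<close> m(1)] m(2) by simp
  qed
qed

section \<open>Nuclear points and spatiality\<close>

lemma clopen_separation:
  assumes "x \<in> esakia_points" "y \<in> esakia_points" "x \<noteq> y"
  obtains U where "esakia_clopen U" "x \<in> U" "y \<notin> U" | U where "esakia_clopen U" "x \<notin> U" "y \<in> U"
proof -
  have mem: "z \<in> phi a \<longleftrightarrow> a \<in> z" if "z \<in> esakia_points" for z a
    using that unfolding phi_def by simp
  consider a where "a \<in> x" "a \<notin> y" | a where "a \<notin> x" "a \<in> y"
    using assms(3) by (metis set_eqI)
  then show thesis
  proof cases
    case (1 a)
    then show thesis using that(1)[of "phi a"] clopen_phi mem assms(1,2) by metis
  next
    case (2 a)
    then show thesis using that(2)[of "phi a"] clopen_phi mem assms(1,2) by metis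
  qed
qed

text \<open>A clopen neighbourhood of a point of \<open>N - M\<close> that misses \<open>M\<close>
  cuts out a nonempty nuclear part of \<open>N\<close>; its nuclear points lie in
  \<open>gamma N\<close> but not in \<open>gamma M\<close>.\<close>

lemma gamma_subset_imp_subset:
  fixes N M :: "'a::frame set set"
  assumes meets: "\<And>N :: 'a set set. N \<in> nuclear_sets \<Longrightarrow> N \<noteq> {} \<Longrightarrow> N \<inter> nuclear_points \<noteq> {}"
    and N: "N \<in> nuclear_sets" and M: "M \<in> nuclear_sets" and sub: "gamma N \<subseteq> gamma M"
  shows "N \<subseteq> M"
proof (rule subsetI, rule ccontr)
  fix x assume x: "x \<in> N" "x \<notin> M"
  moreover have "closedin esakia_space M" using M unfolding nuclear_sets_def by blast
  ultimately obtain U where U: "esakia_clopen U" "x \<in> U" "U \<inter> M = {}"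
    using closed_clopen_separation nuclear_set_subset[OF N] by (metis subsetD)
  then have "N \<inter> U \<in> nuclear_sets" "N \<inter> U \<noteq> {}" using nuclear_Int_clopen[OF N] x by blast+
  then show False using meets[of "N \<inter> U"] sub U(3) unfolding gamma_def by blast
qed

text \<open>A closed set \<open>C\<close> of nuclear points is a union of nuclear singletons, so it
  has a least nuclear superset \<open>N\<close>. Leastness keeps \<open>N\<close> inside every
  closed \<open>F\<close> that cuts out \<open>C\<close>, so \<open>N\<close> acquires no further
  nuclear points.\<close>

lemma gamma_surj: "gamma ` nuclear_sets = closeds_Y"
proof (intro subset_antisym subsetI)
  fix C assume "C \<in> gamma ` nuclear_sets"
  then show "C \<in> closeds_Y" using gamma_closed by blast
next
  fix C :: "'a set set" assume "C \<in> closeds_Y"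
  then obtain F where F: "closedin esakia_space F" "C = F \<inter> nuclear_points"
    unfolding closeds_Y_def nuclear_space_def closedin_subtopology by blast
  have "(\<lambda>y. {y}) ` C \<subseteq> nuclear_sets" using F(2) unfolding nuclear_points_def by blast
  then obtain N where N: "N \<in> nuclear_sets" "C \<subseteq> N"
    and least: "\<And>M. M \<in> nuclear_sets \<Longrightarrow> C \<subseteq> M \<Longrightarrow> N \<subseteq> M"
    by (rule ex_least_nuclear_superset) auto
  have "N \<subseteq> F"
  proof (rule subsetI, rule ccontr)
    fix x assume x: "x \<in> N" "x \<notin> F"
    then obtain U where U: "esakia_clopen U" "x \<in> U" "U \<inter> F = {}"
      using closed_clopen_separation[OF F(1)] nuclear_set_subset[OF N(1)] by (metis subsetD)
    \<comment> \<open>Removing the clopen \<open>U\<close> leaves a nuclear set that still contains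
      \<open>C\<close>, so leastness applies to \<open>N - U\<close>.\<close>
    then have "N \<subseteq> N - U"
      using N F(2) by (intro least nuclear_Diff_clopen) blast+
    then show False using x(1) U(2) by blast
  qed
  then have "gamma N = C" using N(2) F(2) unfolding gamma_def by blast
  then show "C \<in> gamma ` nuclear_sets" using N(1) by blast
qed

section \<open>Criteria for isomorphism\<close>

lemma order_iso_onI:
  assumes "\<And>x y. x \<in> A \<Longrightarrow> y \<in> A \<Longrightarrow> f x \<le> f y \<longleftrightarrow> x \<le> y" "f ` A = B"
  shows "order_iso_on f A B"
proof -
  have "inj_on f A"
  proof (rule inj_onI)
    fix x y assume xy: "x \<in> A" "y \<in> A" "f x = f y"
    then have "x \<le> y" "y \<le> x" using assms(1)[of x y] assms(1)[of y x] by simp_all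
    then show "x = y" by (rule order.antisym)
  qed
  then show ?thesis using assms unfolding order_iso_on_def bij_betw_def by simp
qed

text \<open>A single cycle of implications gives both equivalences. It closes because
  \<open>{}\<close> is nuclear and \<open>gamma {} = {}\<close>, so injectivity forces
  \<open>gamma N\<close> to be nonempty for nonempty \<open>N\<close>.\<close>

lemma nuclear_points_iff_gamma_iso:
  "(\<forall>N \<in> (nuclear_sets :: 'a::frame set set set). N \<noteq> {} \<longrightarrow> N \<inter> nuclear_points \<noteq> {})
    \<longleftrightarrow> order_iso_on gamma (nuclear_sets :: 'a set set set) closeds_Y" (is ?thesis1)
  and gamma_inj_iff_gamma_iso:
  "inj_on gamma (nuclear_sets :: 'a set set set)
    \<longleftrightarrow> order_iso_on gamma (nuclear_sets :: 'a set set set) closeds_Y" (is ?thesis2)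
proof -
  have "order_iso_on gamma (nuclear_sets :: 'a set set set) closeds_Y"
    if meets: "\<forall>N \<in> (nuclear_sets :: 'a set set set). N \<noteq> {} \<longrightarrow> N \<inter> nuclear_points \<noteq> {}"
  proof (rule order_iso_onI[OF _ gamma_surj])
    fix N M :: "'a set set" assume "N \<in> nuclear_sets" "M \<in> nuclear_sets"
    then show "gamma N \<subseteq> gamma M \<longleftrightarrow> N \<subseteq> M"
      using gamma_subset_imp_subset meets unfolding gamma_def by blast
  qed
  moreover have "inj_on gamma (nuclear_sets :: 'a set set set)"
    if "order_iso_on gamma (nuclear_sets :: 'a set set set) closeds_Y"
    using that unfolding order_iso_on_def bij_betw_def by blast
  moreover have "N \<inter> nuclear_points \<noteq> {}"
    if "inj_on gamma (nuclear_sets :: 'a set set set)" "N \<in> nuclear_sets" "N \<noteq> {}" for N :: "'a set set"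
    using inj_onD[OF that(1), of N "{}"] that(2,3) nuclear_empty by (auto simp: gamma_def)
  ultimately show ?thesis1 ?thesis2 by blast+
qed

text \<open>Passing from a nucleus to its nuclear set and taking complements in \<open>Y\<close>
  both reverse the order, so with the isomorphism \<open>gamma\<close> in between the composite
  preserves it.\<close>

lemma nuclei_iso_opens_Y:
  assumes iso: "order_iso_on gamma (nuclear_sets :: 'a::frame set set set) closeds_Y"
  shows "order_isomorphic (nuclei :: ('a \<Rightarrow> 'a) set) (opens_Y :: 'a set set set)"
proof -
  define Y where "Y = (nuclear_points :: 'a set set)"
  have Y: "topspace nuclear_space = Y"
    unfolding Y_def nuclear_space_def nuclear_points_def by auto
  have opens: "U \<in> opens_Y \<longleftrightarrow> U \<subseteq> Y \<and> Y - U \<in> closeds_Y" for U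
    unfolding opens_Y_def closeds_Y_def using openin_closedin_eq[of nuclear_space U] Y by auto
  have gamma_Y: "gamma N \<subseteq> Y" for N unfolding gamma_def Y_def by blast
  have "order_iso_on (\<lambda>j. Y - gamma (nuclear_set_of j)) (nuclei :: ('a \<Rightarrow> 'a) set) opens_Y"
  proof (rule order_iso_onI)
    fix j k :: "'a \<Rightarrow> 'a" assume "j \<in> nuclei" "k \<in> nuclei"
    then have jk: "nucleus j" "nucleus k" unfolding nuclei_def by blast+
    have "Y - gamma (nuclear_set_of j) \<subseteq> Y - gamma (nuclear_set_of k)
        \<longleftrightarrow> gamma (nuclear_set_of k) \<subseteq> gamma (nuclear_set_of j)"
      using gamma_Y by blast
    also have "\<dots> \<longleftrightarrow> nuclear_set_of k \<subseteq> nuclear_set_of j"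
      using iso jk nuclear_set_of_nuclear unfolding order_iso_on_def by blast
    also have "\<dots> \<longleftrightarrow> j \<le> k" using jk by (simp add: nuclear_set_of_subset_iff)
    finally show "Y - gamma (nuclear_set_of j) \<le> Y - gamma (nuclear_set_of k) \<longleftrightarrow> j \<le> k" .
  next
    show "(\<lambda>j. Y - gamma (nuclear_set_of j)) ` nuclei = opens_Y"
    proof (intro subset_antisym subsetI)
      fix U :: "'a set set" assume "U \<in> (\<lambda>j. Y - gamma (nuclear_set_of j)) ` nuclei"
      then obtain j where j: "nucleus j" "U = Y - gamma (nuclear_set_of j)"
        unfolding nuclei_def by blast
      then have "Y - U = gamma (nuclear_set_of j)" using gamma_Y by blast
      then show "U \<in> opens_Y"
        using j gamma_closed[OF nuclear_set_of_nuclear[OF j(1)]] opens by auto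
    next
      fix U :: "'a set set" assume "U \<in> opens_Y"
      then have U: "U \<subseteq> Y" "Y - U \<in> closeds_Y" using opens by blast+
      then obtain N where "N \<in> nuclear_sets" "Y - U = gamma N" using gamma_surj by blast
      moreover obtain j where "nucleus j" "nuclear_set_of j = N"
        using ex_nucleus_of_nuclear_set[OF \<open>N \<in> nuclear_sets\<close>] .
      ultimately have "j \<in> nuclei" "U = Y - gamma (nuclear_set_of j)"
        using U(1) unfolding nuclei_def by blast+
      then show "U \<in> (\<lambda>j. Y - gamma (nuclear_set_of j)) ` nuclei" by blast
    qed
  qed
  then show ?thesis unfolding order_isomorphic_def by blast
qed

text \<open>Nuclear sets correspond to the closed sets of a space \<open>T\<close>. A point
  \<open>t\<close> in the closed set of \<open>N\<close> has a closure, which corresponds to a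
  nuclear \<open>P \<subseteq> N\<close>. Irreducibility of that closure prevents any clopen set
  from splitting \<open>P\<close>, so \<open>P\<close> is a singleton.\<close>

lemma spatial_imp_nuclear_point:
  fixes N :: "'a::frame set set"
  assumes "spatial (nuclei :: ('a \<Rightarrow> 'a) set)" and N: "N \<in> nuclear_sets" "N \<noteq> {}"
  shows "N \<inter> nuclear_points \<noteq> {}"
proof -
  obtain T :: "('a \<Rightarrow> 'a) set topology" and f
    where iso: "order_iso_on f (nuclei :: ('a \<Rightarrow> 'a) set) {U. openin T U}"
    using assms(1) unfolding spatial_def order_isomorphic_def by metis
  then have bij: "bij_betw f (nuclei :: ('a \<Rightarrow> 'a) set) {U. openin T U}"
    and ord: "\<And>j k. nucleus j \<Longrightarrow> nucleus k \<Longrightarrow> f j \<subseteq> f k \<longleftrightarrow> j \<le> k"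
    by (simp_all add: order_iso_on_def nuclei_def)
  have img: "f ` Collect nucleus = {U. openin T U}"
    using bij by (simp add: bij_betw_def nuclei_def)
  have open_f: "openin T (f j)" if "nucleus j" for j
    using img that by blast
  have ex_f: "\<exists>j. nucleus j \<and> f j = U" if "openin T U" for U
  proof -
    have "U \<in> f ` Collect nucleus" using that by (simp add: img)
    then show ?thesis by auto
  qed
  define J where "J M = (SOME j. nucleus j \<and> nuclear_set_of j = M)" for M :: "'a set set"
  have J: "nucleus (J M) \<and> nuclear_set_of (J M) = M" if M: "M \<in> nuclear_sets" for M
  proof -
    have "\<exists>j. nucleus j \<and> nuclear_set_of j = M" using ex_nucleus_of_nuclear_set[OF M] by metis
    from someI_ex[OF this] show ?thesis unfolding J_def .
  qed
  \<comment> \<open>The dual correspondence \<open>J\<close> followed by \<open>f\<close> and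
    complementation reverses the order twice, so \<open>g\<close> is an order isomorphism from
    nuclear sets onto closed sets of \<open>T\<close>.\<close>
  define g where "g M = topspace T - f (J M)" for M
  have closed_g: "closedin T (g M)" if "M \<in> nuclear_sets" for M
    unfolding g_def using open_f J[OF that] by blast
  have ord_g: "g M \<subseteq> g M' \<longleftrightarrow> M \<subseteq> M'" if "M \<in> nuclear_sets" "M' \<in> nuclear_sets" for M M'
  proof -
    have "g M \<subseteq> g M' \<longleftrightarrow> f (J M') \<subseteq> f (J M)"
      unfolding g_def using openin_subset[OF open_f] J that by blast
    also have "\<dots> \<longleftrightarrow> J M' \<le> J M" using ord J that by blast
    also have "\<dots> \<longleftrightarrow> M \<subseteq> M'"
      using nuclear_set_of_subset_iff[of "J M" "J M'"] J that by simp
    finally show ?thesis .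
  qed
  have ex_g: "\<exists>M\<in>nuclear_sets. g M = C" if C: "closedin T C" for C
  proof -
    obtain j where j: "nucleus j" "f j = topspace T - C" using ex_f C by blast
    let ?M = "nuclear_set_of j"
    have M: "?M \<in> nuclear_sets" using j(1) by (rule nuclear_set_of_nuclear)
    then have "J ?M = j"
      using nuclear_set_of_subset_iff[of "J ?M" j] nuclear_set_of_subset_iff[of j "J ?M"] J[OF M] j(1)
      by (simp add: order_antisym)
    then have "g ?M = C" unfolding g_def using j(2) closedin_subset[OF C] by auto
    then show ?thesis using M by blast
  qed
  \<comment> \<open>If \<open>g N\<close> were empty, then \<open>N \<subseteq> E\<close>; and
    \<open>E \<subseteq> {}\<close>, since \<open>g E\<close> is contained in
    \<open>g {}\<close>.\<close>
  obtain E where "E \<in> nuclear_sets" "g E = {}" using ex_g by blast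
  then have "g N \<noteq> {}" using ord_g[OF N(1) \<open>E \<in> nuclear_sets\<close>] ord_g[OF \<open>E \<in> nuclear_sets\<close> nuclear_empty]
    using N(2) by blast
  then obtain t where t: "t \<in> g N" by blast
  have tT: "t \<in> topspace T" using t unfolding g_def by blast
  \<comment> \<open>As \<open>g P\<close> is the least closed set containing \<open>t\<close>,
    \<open>P\<close> is the least nuclear set whose image contains \<open>t\<close>.\<close>
  obtain P where P: "P \<in> nuclear_sets" "g P = T closure_of {t}"
    using ex_g[OF closedin_closure_of] by metis
  have t_P: "t \<in> g P" using P(2) tT by (simp add: in_closure_of)
  have P_sub: "P \<subseteq> M" if "M \<in> nuclear_sets" "t \<in> g M" for M
    using ord_g[OF P(1) that(1)] closure_of_minimal[OF _ closed_g[OF that(1)], of "{t}"] that(2) P(2)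
    by simp
  have split: "P \<subseteq> U \<or> P \<inter> U = {}" if U: "esakia_clopen U" for U
  proof -
    let ?A = "P \<inter> U" and ?B = "P - U"
    have AB: "?A \<in> nuclear_sets" "?B \<in> nuclear_sets"
      using P(1) U by (rule nuclear_Int_clopen nuclear_Diff_clopen)+
    \<comment> \<open>The set \<open>D\<close> contains both parts, hence \<open>P\<close>. So
      \<open>t\<close> lies in the image of one of the parts, and leastness puts \<open>P\<close>
      inside that part.\<close>
    obtain D where D: "D \<in> nuclear_sets" "g D = g ?A \<union> g ?B"
      using ex_g[OF closedin_Un[OF closed_g[OF AB(1)] closed_g[OF AB(2)]]] by metis
    have "?A \<subseteq> D" "?B \<subseteq> D" using D ord_g[OF AB(1) D(1)] ord_g[OF AB(2) D(1)] by auto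
    then have "P \<subseteq> D" by blast
    then have "t \<in> g ?A \<union> g ?B" using ord_g[OF P(1) D(1)] t_P D(2) by blast
    then show ?thesis using P_sub AB by blast
  qed
  have "P \<noteq> {}" using t_P \<open>g E = {}\<close> ord_g[OF P(1) \<open>E \<in> nuclear_sets\<close>] by blast
  then obtain y where y: "y \<in> P" by blast
  have "x = y" if x: "x \<in> P" for x
  proof (rule ccontr)
    assume "x \<noteq> y"
    moreover have "x \<in> esakia_points" "y \<in> esakia_points"
      using x y nuclear_set_subset[OF P(1)] by blast+
    ultimately obtain U where "esakia_clopen U" "(x \<in> U) \<noteq> (y \<in> U)"
      using clopen_separation by metis
    then show False using split[of U] x y by blast
  qed
  then have "P = {y}" using y by blast
  then have "y \<in> nuclear_points"
    using P(1) nuclear_set_subset[OF P(1)] unfolding nuclear_points_def by blast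
  moreover have "y \<in> N" using P_sub[OF N(1) t] y by blast
  ultimately show ?thesis by blast
qed

theorem theorem5p10:
  shows "(spatial (nuclei :: ('a::frame \<Rightarrow> 'a) set)
            \<longleftrightarrow> (\<forall>N \<in> (nuclear_sets :: 'a set set set). N \<noteq> {} \<longrightarrow> N \<inter> nuclear_points \<noteq> {})) \<and>
         ((\<forall>N \<in> (nuclear_sets :: 'a set set set). N \<noteq> {} \<longrightarrow> N \<inter> nuclear_points \<noteq> {})
            \<longleftrightarrow> inj_on gamma (nuclear_sets :: 'a set set set)) \<and>
         (inj_on gamma (nuclear_sets :: 'a set set set)
            \<longleftrightarrow> order_iso_on gamma (nuclear_sets :: 'a set set set) closeds_Y) \<and>
         (order_iso_on gamma (nuclear_sets :: 'a set set set) closeds_Y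
            \<longleftrightarrow> order_isomorphic (nuclei :: ('a \<Rightarrow> 'a) set) (opens_Y :: 'a set set set))"
proof -
  have "spatial (nuclei :: ('a \<Rightarrow> 'a) set)"
    if "order_isomorphic (nuclei :: ('a \<Rightarrow> 'a) set) (opens_Y :: 'a set set set)"
    using that unfolding opens_Y_def by (rule spatialI)
  moreover have "\<forall>N \<in> (nuclear_sets :: 'a set set set). N \<noteq> {} \<longrightarrow> N \<inter> nuclear_points \<noteq> {}"
    if "spatial (nuclei :: ('a \<Rightarrow> 'a) set)"
    using spatial_imp_nuclear_point[OF that] by simp
  \<comment> \<open>The conditions on \<open>gamma\<close> are equivalent and imply the isomorphism
    with \<open>opens_Y\<close>; the two implications above lead from there through spatiality back
    to nonempty \<open>N \<inter> nuclear_points\<close>.\<close>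
  ultimately show ?thesis
    using nuclear_points_iff_gamma_iso[where 'a = 'a] gamma_inj_iff_gamma_iso[where 'a = 'a]
      nuclei_iso_opens_Y[where 'a = 'a]
    by argo
qed

end
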